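(* Let $q$ be a prime power, $u,v$ non-zero elements of $\mathbb{F}_q$, and set $\theta=\theta(q-1)$, $W=W(q-1)$. Let $\varepsilon$ be the number of zeros of $ux^2+v$ in $\mathbb{F}_q$. Then $$\left|M(q,u,v)-\theta^2(q-1-\varepsilon)\right|\leq \theta^2\left\{2\sqrt{q}\left[W^2-W-\frac12\left(\frac1\theta-1\right)\right]+\varepsilon(W-1)\right\}.$$
   Context: A primitive element of $\mathbb{F}_q$ is a generator of $\mathbb{F}_q^*$. $M(q,u,v)$ is the number of primitive elements $a\in\mathbb{F}_q$ such that $ua+va^{-1}$ is also primitive. $\omega(m)$ is the number of distinct prime divisors of $m$, $W(m)=2^{\omega(m)}$, $\theta(m)=\phi(m)/m$. *)

theory Defs
  imports "HOL-Number_Theory.Number_Theory"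
begin

definition primitive_elem :: "'a::{field,finite} \<Rightarrow> bool" where
  "primitive_elem a \<longleftrightarrow> a \<noteq> 0 \<and> range (\<lambda>k::nat. a ^ k) = UNIV - {0}"

definition M_count :: "'a::{field,finite} \<Rightarrow> 'a \<Rightarrow> nat" where
  "M_count u v = card {a. primitive_elem a \<and> primitive_elem (u * a + v * inverse a)}"

definition omega :: "nat \<Rightarrow> nat" where
  "omega m = card (prime_factors m)"

definition W_fun :: "nat \<Rightarrow> nat" where
  "W_fun m = 2 ^ omega m"

definition theta :: "nat \<Rightarrow> real" where
  "theta m = real (totient m) / real m"

end

theory Submission
  imports Defs
begin

text \<open>
  Let \<open>n = q - 1\<close> and let \<open>\<chi>\<^sub>k\<close>, \<open>k < n\<close>, be the multiplicative characters. The indicator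
  function of the primitive elements is \<open>\<Sum>\<^sub>k c\<^sub>k \<chi>\<^sub>k\<close> up to conjugation, so \<open>M(q,u,v)\<close> is a
  combination, with coefficients \<open>c\<^sub>k c\<^sub>l\<close>, of the sums \<open>S\<^sub>k\<^sub>l = \<Sum>\<^sub>a \<chi>\<^sub>k(a) \<chi>\<^sub>l(ua + v/a)\<close>.
  Orders of characters never enter: only \<open>c\<^sub>0 = \<theta>\<close>, the bound \<open>\<Sum> |c\<^sub>k| \<le> \<theta>W\<close> (each prime divisor
  \<open>p\<close> of \<open>n\<close> contributes a factor \<open>1 - [p | j]\<close>, whose Fourier transform has norm \<open>2(1 - 1/p)\<close>
  in the Wiener algebra) and Parseval's identity \<open>\<Sum> |c\<^sub>k|\<^sup>2 = \<theta>\<close> are needed.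

  Since \<open>S\<^sub>k\<^sub>l = \<Sum>\<^sub>a (\<chi>\<^sub>k/\<chi>\<^sub>l)(a) \<chi>\<^sub>l(ua\<^sup>2 + v)\<close>, it is a sum of at most two Jacobi sums if
  \<open>\<chi>\<^sub>k/\<chi>\<^sub>l\<close> is a square, and vanishes by the symmetry \<open>a \<mapsto> -a\<close> otherwise; hence
  \<open>|S\<^sub>k\<^sub>l| \<le> 2\<surd>q\<close> for \<open>l \<noteq> 0\<close>. The term \<open>-(1/\<theta> - 1)/2\<close> is gained from \<open>k = l\<close> and \<open>k = -l\<close>,
  where one of the Jacobi sums has absolute value 1.
\<close>

section \<open>Fourier analysis modulo n\<close>

definition zeta :: "nat \<Rightarrow> complex" where
  "zeta n = cis (2 * pi / real n)"

lemma norm_zeta [simp]: "norm (zeta n) = 1"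
  by (simp add: zeta_def)

lemma cnj_zeta_power: "cnj (zeta n ^ m) * zeta n ^ m = 1"
  by (metis complex_cnj_power complex_norm_square mult.commute norm_one norm_power norm_zeta
      of_real_1 power_one)

lemma zeta_power_conv_cis: "zeta n ^ m = cis (2 * pi * real m / real n)"
  by (simp add: zeta_def DeMoivre mult_ac)

lemma zeta_power_self: "n > 0 \<Longrightarrow> zeta n ^ n = 1"
  by (simp add: zeta_power_conv_cis)

lemma zeta_power_mod:
  assumes "n > 0"
  shows "zeta n ^ (m mod n) = zeta n ^ m"
proof -
  have "zeta n ^ m = zeta n ^ (n * (m div n) + m mod n)"
    by (simp only: mult_div_mod_eq)
  also have "\<dots> = zeta n ^ (m mod n)"
    using assms by (simp only: power_add power_mult zeta_power_self power_one mult_1)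
  finally show ?thesis ..
qed

lemma zeta_power_cong: "n > 0 \<Longrightarrow> [a = b] (mod n) \<Longrightarrow> zeta n ^ a = zeta n ^ b"
  by (metis cong_def zeta_power_mod)

lemma zeta_power_eq_1_iff:
  assumes "n > 0"
  shows "zeta n ^ m = 1 \<longleftrightarrow> n dvd m"
proof
  assume "zeta n ^ m = 1"
  then have eq: "zeta n ^ (m mod n) = zeta n ^ 0"
    using assms by (simp add: zeta_power_mod)
  have "inj_on (\<lambda>k. cis (2 * pi * real k / real n)) {..<n}"
    using bij_betw_roots_unity[OF assms] by (rule bij_betw_imp_inj_on)
  then have "m mod n = 0"
    by (rule inj_onD) (use eq assms in \<open>simp_all add: zeta_power_conv_cis\<close>)
  then show "n dvd m" by auto
next
  assume "n dvd m"
  then show "zeta n ^ m = 1"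
    using assms by (auto simp: power_mult zeta_power_self elim!: dvdE)
qed

lemma zeta_power_half:
  assumes "n > 0" "even n"
  shows "zeta n ^ (n div 2) = -1"
proof -
  have "(zeta n ^ (n div 2))\<^sup>2 = 1"
    using assms by (simp flip: power_mult add: zeta_power_self)
  moreover have "\<not> n dvd n div 2"
    using assms by (auto dest!: dvd_imp_le)
  then have "zeta n ^ (n div 2) \<noteq> 1"
    using assms by (simp add: zeta_power_eq_1_iff)
  ultimately show ?thesis by (simp add: power2_eq_1_iff)
qed

lemma sum_zeta_power:
  assumes "n > 0"
  shows "(\<Sum>k<n. zeta n ^ (k * m)) = (if n dvd m then of_nat n else 0)"
proof (cases "n dvd m")
  case True
  have "zeta n ^ (k * m) = 1" for k
    using True assms by (simp add: zeta_power_eq_1_iff)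
  then show ?thesis using True by simp
next
  case False
  then have ne: "zeta n ^ m \<noteq> 1" using assms by (simp add: zeta_power_eq_1_iff)
  have "(\<Sum>k<n. zeta n ^ (k * m)) = (\<Sum>k<n. (zeta n ^ m) ^ k)"
    by (simp add: power_mult [symmetric] mult.commute)
  also have "\<dots> = ((zeta n ^ m) ^ n - 1) / (zeta n ^ m - 1)"
    using ne by (rule geometric_sum)
  also have "(zeta n ^ m) ^ n = 1"
    using assms by (metis dvd_triv_right power_mult zeta_power_eq_1_iff)
  finally show ?thesis using False by simp
qed

text \<open>Translation modulo \<open>n\<close> is an injective self-map of a finite set. This is
  what makes all frequency shifts of a transform have the same norm sum.\<close>

lemma sum_lessThan_add_mod:
  fixes F :: "nat \<Rightarrow> 'b::comm_monoid_add"
  assumes "n > 0"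
  shows "(\<Sum>k<n. F ((k + s) mod n)) = (\<Sum>k<n. F k)"
proof (rule sum.reindex_bij_betw)
  have inj: "inj_on (\<lambda>k. (k + s) mod n) {..<n}"
  proof (rule inj_onI)
    fix a b assume "a \<in> {..<n}" "b \<in> {..<n}" "(a + s) mod n = (b + s) mod n"
    then show "a = b"
      by (metis cong_add_rcancel_nat cong_def lessThan_iff mod_less)
  qed
  have "(\<lambda>k. (k + s) mod n) ` {..<n} \<subseteq> {..<n}"
    using assms by auto
  then show "bij_betw (\<lambda>k. (k + s) mod n) {..<n} {..<n}"
    using inj by (simp add: bij_betw_def endo_inj_surj)
qed

section \<open>Unnormalised discrete Fourier transform: inversion and Parseval\<close>

definition dft :: "nat \<Rightarrow> (nat \<Rightarrow> complex) \<Rightarrow> nat \<Rightarrow> complex" where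
  "dft n f k = (\<Sum>j<n. f j * zeta n ^ (k * j))"

lemma dft_mod: "n > 0 \<Longrightarrow> dft n f (k mod n) = dft n f k"
  unfolding dft_def
  by (intro sum.cong refl arg_cong[where f = "\<lambda>x. _ * x"] zeta_power_cong)
     (auto simp: cong_def mod_mult_left_eq)

lemma dft_inversion:
  assumes "j < n"
  shows "(\<Sum>k<n. dft n f k * cnj (zeta n ^ (k * j))) = of_nat n * f j"
proof -
  have n: "n > 0" using assms by simp
  have orth: "(\<Sum>k<n. zeta n ^ (k * i) * cnj (zeta n ^ (k * j))) = (if i = j then of_nat n else 0)"
    if i: "i < n" for i
  proof -
    \<comment> \<open>The exponent \<open>-j\<close> is represented by the natural number
      \<open>n - j\<close>, so that the product is a single power and \<open>sum_zeta_power\<close>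
      applies.\<close>
    have "zeta n ^ (k * i) * cnj (zeta n ^ (k * j)) = zeta n ^ (k * (i + (n - j)))" for k
    proof -
      have 1: "zeta n ^ (k * (n - j)) * zeta n ^ (k * j) = 1"
        using n assms by (simp add: power_add [symmetric] add_mult_distrib2 [symmetric]
            zeta_power_eq_1_iff)
      have "cnj (zeta n ^ (k * j)) = zeta n ^ (k * (n - j))"
        using 1 cnj_zeta_power[of n "k * j"] norm_zeta
        by (metis mult_right_cancel power_not_zero norm_zero zero_neq_one)
      then show ?thesis by (simp add: power_add add_mult_distrib2)
    qed
    moreover have "n dvd i + (n - j) \<longleftrightarrow> i = j"
    proof
      assume d: "n dvd i + (n - j)"
      then obtain c where c: "i + (n - j) = n * c" by (elim dvdE)
      \<comment> \<open>As \<open>i\<close> and \<open>j\<close> are below \<open>n\<close>, the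
        only multiple of \<open>n\<close> that \<open>i + (n - j)\<close> can equal is
        \<open>n\<close> itself.\<close>
      have "0 < n * c" "n * c < n * 2" using assms i by (simp_all flip: c)
      then have "c = 1" by auto
      then show "i = j" using c assms i by auto
    qed (use assms in auto)
    ultimately show ?thesis using sum_zeta_power[OF n, of "i + (n - j)"] by simp
  qed
  have "(\<Sum>k<n. dft n f k * cnj (zeta n ^ (k * j)))
      = (\<Sum>k<n. \<Sum>i<n. f i * (zeta n ^ (k * i) * cnj (zeta n ^ (k * j))))"
    by (simp add: dft_def sum_distrib_right mult.assoc)
  also have "\<dots> = (\<Sum>i<n. f i * (\<Sum>k<n. zeta n ^ (k * i) * cnj (zeta n ^ (k * j))))"
    by (subst sum.swap) (simp add: sum_distrib_left)
  also have "\<dots> = (\<Sum>i<n. f i * (if i = j then of_nat n else 0))"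
    by (intro sum.cong refl) (simp only: orth lessThan_iff)
  also have "\<dots> = of_nat n * f j"
    using assms by (simp add: if_distrib sum.delta' mult.commute cong: if_cong)
  finally show ?thesis .
qed

text \<open>Only the conjugated transform is expanded; the inner sum over \<open>k\<close> is then
  evaluated by inversion.\<close>

lemma dft_parseval:
  "(\<Sum>k<n. (norm (dft n f k))\<^sup>2) = real n * (\<Sum>j<n. (norm (f j))\<^sup>2)"
proof -
  have "complex_of_real (\<Sum>k<n. (norm (dft n f k))\<^sup>2) = (\<Sum>k<n. dft n f k * cnj (dft n f k))"
    by (simp only: of_real_sum complex_norm_square)
  also have "\<dots> = (\<Sum>k<n. \<Sum>j<n. cnj (f j) * (dft n f k * cnj (zeta n ^ (k * j))))"
    unfolding dft_def[of n f "_"] cnj_sum by (simp add: sum_distrib_left mult_ac)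
  also have "\<dots> = (\<Sum>j<n. cnj (f j) * (\<Sum>k<n. dft n f k * cnj (zeta n ^ (k * j))))"
    by (subst sum.swap) (simp add: sum_distrib_left)
  also have "\<dots> = (\<Sum>j<n. cnj (f j) * (of_nat n * f j))"
    by (intro sum.cong refl) (simp only: dft_inversion lessThan_iff)
  also have "\<dots> = complex_of_real (real n * (\<Sum>j<n. (norm (f j))\<^sup>2))"
    by (simp only: sum_distrib_left of_real_mult of_real_of_nat_eq of_real_sum complex_norm_square mult_ac)
  finally show ?thesis by (simp only: of_real_eq_iff)
qed

text \<open>Multiplication by a character permutes the Fourier coefficients, and the indicator of
  \<open>p dvd j\<close> is the mean of \<open>p\<close> characters, one of which is trivial.\<close>

lemma dft_sieve_prime:
  assumes p: "prime p" "p dvd n" and n: "n > 0"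
  shows "(\<Sum>k<n. norm (dft n (\<lambda>j. if p dvd j then 0 else f j) k))
       \<le> 2 * (1 - 1 / real p) * (\<Sum>k<n. norm (dft n f k))"
proof -
  define h where "h = n div p"
  have nh: "n = p * h" using p by (simp add: h_def)
  have p0: "p > 0" using p by (simp add: prime_gt_0_nat)
  have h0: "h > 0" using nh n by (cases h) auto
  \<comment> \<open>Hence the characters of order dividing \<open>p\<close> are
    \<open>j \<mapsto> zeta n ^ (l * h * j)\<close>, and multiplying by one of them shifts the
    frequency by \<open>l * h\<close>.\<close>
  have zp: "zeta n ^ h = zeta p"
    using h0 by (simp add: zeta_power_conv_cis nh) (simp add: zeta_def)
  \<comment> \<open>The term \<open>l = 0\<close> of the mean is merged with the leading
    \<open>1\<close>. The coefficient norms then add up to \<open>(1 - 1/p) + (p - 1)/p\<close>;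
    left separate, they would only give \<open>2\<close>.\<close>
  have ind: "(if p dvd j then 0 else f j)
      = (1 - 1 / of_nat p) * f j - (1 / of_nat p) * (\<Sum>l=1..<p. zeta n ^ (l * h * j) * f j)" for j
  proof -
    have "(\<Sum>l<p. zeta n ^ (l * h * j)) = (\<Sum>l<p. zeta p ^ (l * j))"
      by (intro sum.cong refl) (metis zp mult.assoc mult.commute power_mult)
    also have "\<dots> = (if p dvd j then of_nat p else 0)"
      using p0 by (rule sum_zeta_power)
    finally have *: "(\<Sum>l<p. zeta n ^ (l * h * j)) = (if p dvd j then of_nat p else 0)" .
    have "(\<Sum>l<p. zeta n ^ (l * h * j)) = 1 + (\<Sum>l=1..<p. zeta n ^ (l * h * j))"
      using p0 unfolding lessThan_atLeast0 by (subst sum.atLeast_Suc_lessThan) auto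
    with * have "(\<Sum>l=1..<p. zeta n ^ (l * h * j)) = (if p dvd j then of_nat p else 0) - 1"
      by (simp add: algebra_simps)
    then have "(\<Sum>l=1..<p. zeta n ^ (l * h * j) * f j) = ((if p dvd j then of_nat p else 0) - 1) * f j"
      by (simp only: sum_distrib_right [symmetric])
    then show ?thesis using p0 by (simp only:) (simp add: field_simps)
  qed
  have dft_eq: "dft n (\<lambda>j. if p dvd j then 0 else f j) k
      = (1 - 1 / of_nat p) * dft n f k - (1 / of_nat p) * (\<Sum>l=1..<p. dft n f (k + l * h))" for k
  proof -
    have "(\<Sum>l=1..<p. dft n f (k + l * h))
        = (\<Sum>j<n. \<Sum>l=1..<p. zeta n ^ (l * h * j) * f j * zeta n ^ (k * j))"
      unfolding dft_def by (subst sum.swap) (simp add: algebra_simps power_add)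
    then have "(1 / of_nat p) * (\<Sum>l=1..<p. dft n f (k + l * h))
        = (\<Sum>j<n. (1 / of_nat p) * (\<Sum>l=1..<p. zeta n ^ (l * h * j) * f j) * zeta n ^ (k * j))"
      by (simp only: sum_distrib_left sum_distrib_right mult.assoc)
    moreover have "(1 - 1 / of_nat p) * dft n f k
        = (\<Sum>j<n. (1 - 1 / of_nat p) * f j * zeta n ^ (k * j))"
      unfolding dft_def by (simp only: sum_distrib_left mult.assoc)
    moreover have "dft n (\<lambda>j. if p dvd j then 0 else f j) k
        = (\<Sum>j<n. (1 - 1 / of_nat p) * f j * zeta n ^ (k * j))
        - (\<Sum>j<n. (1 / of_nat p) * (\<Sum>l=1..<p. zeta n ^ (l * h * j) * f j) * zeta n ^ (k * j))"
      unfolding dft_def ind left_diff_distrib[of _ _ "zeta n ^ _"] sum_subtractf by (rule refl)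
    ultimately show ?thesis by (simp only:)
  qed
  have p1: "1 - 1 / real p \<ge> 0" using p0 by simp
  have "norm (dft n (\<lambda>j. if p dvd j then 0 else f j) k)
     \<le> (1 - 1 / real p) * norm (dft n f k) + (1 / real p) * (\<Sum>l=1..<p. norm (dft n f (k + l * h)))" for k
  proof -
    have "norm (1 - 1 / of_nat p :: complex) = 1 - 1 / real p"
      using p1 by (metis norm_of_real abs_of_nonneg of_real_1 of_real_diff of_real_divide of_real_of_nat_eq)
    then show ?thesis
      unfolding dft_eq
      by (intro order_trans[OF norm_triangle_ineq4] add_mono)
         (simp_all add: norm_mult norm_divide divide_right_mono norm_sum)
  qed
  then have "(\<Sum>k<n. norm (dft n (\<lambda>j. if p dvd j then 0 else f j) k))
    \<le> (\<Sum>k<n. (1 - 1 / real p) * norm (dft n f k) + (1 / real p) * (\<Sum>l=1..<p. norm (dft n f (k + l * h))))"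
    by (intro sum_mono)
  also have "\<dots> = (1 - 1 / real p) * (\<Sum>k<n. norm (dft n f k))
       + (1 / real p) * (\<Sum>k<n. \<Sum>l=1..<p. norm (dft n f (k + l * h)))"
    by (simp only: sum.distrib sum_distrib_left)
  also have "(\<Sum>k<n. \<Sum>l=1..<p. norm (dft n f (k + l * h))) = (\<Sum>l=1..<p. \<Sum>k<n. norm (dft n f ((k + l * h) mod n)))"
    by (subst sum.swap) (simp only: dft_mod[OF n])
  also have "\<dots> = real (p - 1) * (\<Sum>k<n. norm (dft n f k))"
    by (simp add: sum_lessThan_add_mod[OF n, of "\<lambda>k. norm (dft n f k)"])
  also have "(1 - 1 / real p) * (\<Sum>k<n. norm (dft n f k)) + (1 / real p) * \<dots>
    = 2 * (1 - 1 / real p) * (\<Sum>k<n. norm (dft n f k))"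
    using p0 by (simp add: of_nat_diff field_simps)
  finally show ?thesis .
qed

text \<open>Induction over the primes sieved out so far: the constant function has its whole
  transform, of size \<open>n\<close>, at frequency 0, and each further prime costs one
  factor.\<close>

lemma dft_sieve:
  assumes n: "n > 0" and P: "P \<subseteq> prime_factors n"
  shows "(\<Sum>k<n. norm (dft n (\<lambda>j. if \<exists>p\<in>P. p dvd j then 0 else 1) k))
       \<le> real n * (\<Prod>p\<in>P. 2 * (1 - 1 / real p))"
proof -
  have "finite P" using P by (rule finite_subset) simp
  then show ?thesis using P
  proof (induction P rule: finite_induct)
    case empty
    have "dft n (\<lambda>j. 1) k = (if k = 0 then of_nat n else 0)" if "k < n" for k
      using sum_zeta_power[OF n, of k] that by (auto simp: dft_def mult.commute dest: dvd_imp_le)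
    then have "(\<Sum>k<n. norm (dft n (\<lambda>j. 1) k)) = (\<Sum>k<n. if k = 0 then real n else 0)"
      by (intro sum.cong) auto
    then show ?case using n by simp
  next
    case (insert p P)
    have "(\<lambda>j. if \<exists>r\<in>insert p P. r dvd j then 0 else 1 :: complex)
        = (\<lambda>j. if p dvd j then 0 else (if \<exists>r\<in>P. r dvd j then 0 else 1))"
      by auto
    then have "(\<Sum>k<n. norm (dft n (\<lambda>j. if \<exists>r\<in>insert p P. r dvd j then 0 else 1) k))
      \<le> 2 * (1 - 1 / real p) * (\<Sum>k<n. norm (dft n (\<lambda>j. if \<exists>r\<in>P. r dvd j then 0 else 1) k))"
      using insert.prems n by (simp only:) (rule dft_sieve_prime; auto)
    also have "\<dots> \<le> 2 * (1 - 1 / real p) * (real n * (\<Prod>p\<in>P. 2 * (1 - 1 / real p)))"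
      using insert.IH insert.prems by (intro mult_left_mono) (auto simp: field_simps dest!: in_prime_factors_imp_prime prime_gt_0_nat)
    finally show ?case using insert.hyps by (simp add: mult_ac)
  qed
qed

section \<open>Ramanujan sums divided by \<open>n\<close>: Fourier coefficients of the coprimality
  indicator\<close>

definition ramanujan_coeff :: "nat \<Rightarrow> nat \<Rightarrow> complex" where
  "ramanujan_coeff n k = dft n (\<lambda>j. of_bool (coprime j n)) k / of_nat n"

text \<open>\<open>totatives n\<close> represents the zero class by \<open>n\<close>, here it is
  represented by \<open>0\<close>. Neither is coprime to \<open>n\<close> unless
  \<open>n = 1\<close>, which is the field with two elements.\<close>

lemma card_coprime_lessThan:
  assumes "n > 0"
  shows "card {j. j < n \<and> coprime j n} = totient n"
proof (cases "n = 1")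
  case False
  have "{j. j < n \<and> coprime j n} = totatives n"
  proof (rule Set.set_eqI, rule iffI)
    fix j assume "j \<in> {j. j < n \<and> coprime j n}"
    then show "j \<in> totatives n"
      using False by (cases "j = 0") (auto simp: totatives_def)
  next
    fix j assume "j \<in> totatives n"
    then show "j \<in> {j. j < n \<and> coprime j n}"
      using False by (cases "j = n") (auto simp: totatives_def)
  qed
  then show ?thesis by (simp add: totient_def)
next
  case True
  then have "{j. j < n \<and> coprime j n} = {0}" by auto
  then show ?thesis using True by simp
qed

lemma sum_of_bool_coprime:
  "n > 0 \<Longrightarrow> (\<Sum>j<n. of_bool (coprime j n)) = (of_nat (totient n) :: 'b::semiring_1)"
  by (simp add: card_coprime_lessThan [symmetric] of_bool_def sum.If_cases Int_def lessThan_def)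

text \<open>Coprimality to \<open>n\<close> is the sieve by all prime factors of \<open>n\<close>,
  and Euler's product turns the factors \<open>2 * (1 - 1/p)\<close> into \<open>W\<close> times
  \<open>theta\<close>.\<close>

lemma sum_norm_ramanujan_coeff_le:
  assumes "n > 0"
  shows "(\<Sum>k<n. norm (ramanujan_coeff n k)) \<le> theta n * real (W_fun n)"
proof -
  have "(\<lambda>j. of_bool (coprime j n) :: complex) = (\<lambda>j. if \<exists>p\<in>prime_factors n. p dvd j then 0 else 1)"
  proof
    fix j
    have "coprime j n \<longleftrightarrow> (\<forall>p\<in>prime_factors n. \<not> p dvd j)"
    proof
      assume "coprime j n"
      then show "\<forall>p\<in>prime_factors n. \<not> p dvd j"
        by (meson coprime_common_divisor in_prime_factors_iff not_prime_unit)
    next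
      assume "\<forall>p\<in>prime_factors n. \<not> p dvd j"
      then show "coprime j n"
        using assms
        by (metis coprime_iff_gcd_eq_1 gcd_dvd1 gcd_dvd2 dvd_trans gr0_implies_Suc in_prime_factors_iff
            nat.simps(3) prime_factor_nat)
    qed
    then show "(of_bool (coprime j n) :: complex) = (if \<exists>p\<in>prime_factors n. p dvd j then 0 else 1)"
      by auto
  qed
  then have "(\<Sum>k<n. norm (ramanujan_coeff n k))
      = (\<Sum>k<n. norm (dft n (\<lambda>j. if \<exists>p\<in>prime_factors n. p dvd j then 0 else 1) k)) / real n"
    by (simp only: ramanujan_coeff_def norm_divide norm_of_nat sum_divide_distrib)
  also have "\<dots> \<le> (real n * (\<Prod>p\<in>prime_factors n. 2 * (1 - 1 / real p))) / real n"
    by (intro divide_right_mono dft_sieve[OF assms order_refl]) simp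
  also have "\<dots> = theta n * real (W_fun n)"
  proof -
    have "(\<Prod>p\<in>prime_factors n. 2 * (1 - 1 / real p)) = real (W_fun n) * (\<Prod>p\<in>prime_factors n. 1 - 1 / real p)"
      by (simp only: prod.distrib prod_constant W_fun_def omega_def of_nat_power of_nat_numeral)
    then show ?thesis using assms by (simp add: theta_def totient_formula2)
  qed
  finally show ?thesis .
qed

lemma ramanujan_coeff_0: "n > 0 \<Longrightarrow> ramanujan_coeff n 0 = of_real (theta n)"
  by (simp add: ramanujan_coeff_def dft_def theta_def sum_of_bool_coprime del: sum_of_bool_eq)

text \<open>Parseval for an indicator function, which is its own square.\<close>

lemma sum_norm_ramanujan_coeff_square:
  assumes "n > 0"
  shows "(\<Sum>k<n. (norm (ramanujan_coeff n k))\<^sup>2) = theta n"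
proof -
  have "(\<Sum>k<n. (norm (ramanujan_coeff n k))\<^sup>2) = (\<Sum>k<n. (norm (dft n (\<lambda>j. of_bool (coprime j n)) k))\<^sup>2) / (real n)\<^sup>2"
    by (simp add: ramanujan_coeff_def norm_divide power_divide sum_divide_distrib)
  also have "(\<Sum>j<n. (norm (of_bool (coprime j n) :: complex))\<^sup>2) = real (totient n)"
  proof -
    have "(norm (of_bool (coprime j n) :: complex))\<^sup>2 = of_bool (coprime j n)" for j
      by simp
    then show ?thesis using assms by (simp only: sum_of_bool_coprime)
  qed
  then have "(\<Sum>k<n. (norm (dft n (\<lambda>j. of_bool (coprime j n)) k))\<^sup>2) = real n * real (totient n)"
    by (simp only: dft_parseval)
  finally show ?thesis using assms by (simp add: theta_def power2_eq_square)
qed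

text \<open>Negating the frequency conjugates the transform of a real function.\<close>

lemma norm_ramanujan_coeff_minus:
  assumes "k < n"
  shows "norm (ramanujan_coeff n (n - k)) = norm (ramanujan_coeff n k)"
proof -
  have "zeta n ^ ((n - k) * j) = cnj (zeta n ^ (k * j))" for j
  proof -
    have 1: "zeta n ^ ((n - k) * j) * zeta n ^ (k * j) = 1"
      using assms by (simp add: power_add [symmetric] add_mult_distrib [symmetric]
          zeta_power_eq_1_iff)
    then show ?thesis
      using cnj_zeta_power[of n "k * j"] norm_zeta
      by (metis mult_right_cancel power_not_zero norm_zero zero_neq_one)
  qed
  moreover have "cnj (of_bool P) = of_bool P" for P
    by (cases P) auto
  ultimately have "ramanujan_coeff n (n - k) = cnj (ramanujan_coeff n k)"
    by (simp only: ramanujan_coeff_def dft_def complex_cnj_divide cnj_sum complex_cnj_mult complex_cnj_of_nat)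
  then show ?thesis by simp
qed

text \<open>The bound is the coefficient at 0, which is therefore the largest; this settles the case
  \<open>q = 3\<close> below.\<close>

lemma norm_ramanujan_coeff_le:
  assumes "n > 0"
  shows "norm (ramanujan_coeff n k) \<le> theta n"
proof -
  have "norm (dft n (\<lambda>j. of_bool (coprime j n)) k) \<le> (\<Sum>j<n. of_bool (coprime j n))"
    unfolding dft_def by (rule sum_norm_le) (auto simp: norm_mult norm_power)
  also have "\<dots> = real (totient n)"
    using assms by (rule sum_of_bool_coprime)
  finally show ?thesis by (simp add: ramanujan_coeff_def theta_def norm_divide divide_right_mono)
qed

section \<open>Multiplicative characters and Jacobi sums\<close>

text \<open>The type-class field is repackaged as a ring record \<open>R\<close>, for which the
  cyclicity of the multiplicative group of a finite field is available.\<close>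

lemma ex_primitive_elem: "\<exists>g :: 'a::{field,finite}. primitive_elem g"
proof -
  define R :: "'a ring" where
    "R = \<lparr>carrier = UNIV, mult = (*), one = 1, zero = 0, add = (+)\<rparr>"
  have "cring R"
  proof (rule cringI)
    show "abelian_group R"
    proof (rule abelian_groupI)
      fix x assume "x \<in> carrier R"
      show "\<exists>y\<in>carrier R. y \<oplus>\<^bsub>R\<^esub> x = \<zero>\<^bsub>R\<^esub>"
        by (rule bexI[of _ "- x"]) (auto simp: R_def)
    qed (auto simp: R_def algebra_simps)
    show "Group.comm_monoid R"
      by (rule comm_monoidI) (auto simp: R_def algebra_simps)
  qed (auto simp: R_def algebra_simps)
  then interpret R: cring R .
  have "field R"
  proof (rule R.cring_fieldI2)
    fix a assume "a \<in> carrier R" "a \<noteq> \<zero>\<^bsub>R\<^esub>"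
    then show "\<exists>b\<in>carrier R. a \<otimes>\<^bsub>R\<^esub> b = \<one>\<^bsub>R\<^esub>"
      by (intro bexI[of _ "inverse a"]) (auto simp: R_def)
  qed (auto simp: R_def)
  then interpret R: field R .
  obtain a where a: "a \<in> carrier (mult_of R)"
    "carrier (mult_of R) = {a [^]\<^bsub>R\<^esub> i | i::nat. i \<in> UNIV}"
    using R.finite_field_mult_group_has_gen by (auto simp: R_def)
  have "a [^]\<^bsub>R\<^esub> i = a ^ i" for i :: nat
    by (induction i) (auto simp: R_def mult.commute nat_pow_def)
  then show ?thesis
    using a by (intro exI[of _ a]) (auto simp: primitive_elem_def R_def)
qed

section \<open>Discrete logarithms to the base of a generator\<close>

locale field_generator =
  fixes g :: "'a::{field,finite}" and n :: nat
  assumes primitive_g: "primitive_elem g" and n_def: "n = card (UNIV - {0 :: 'a})"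
begin

lemma g_nonzero [simp]: "g \<noteq> 0"
  using primitive_g by (simp add: primitive_elem_def)

lemma range_power_g: "range (\<lambda>k::nat. g ^ k) = UNIV - {0}"
  using primitive_g by (simp add: primitive_elem_def)

lemma n_pos: "n > 0"
proof -
  have "g \<in> UNIV - {0}" by simp
  then have "UNIV - {0 :: 'a} \<noteq> {}" by blast
  then show ?thesis unfolding n_def by (simp only: card_gt_0_iff finite simp_thms)
qed

lemma card_field: "card (UNIV :: 'a set) = n + 1"
  by (simp add: n_def card_gt_0_iff)

lemma ex_power_g:
  assumes "a \<noteq> 0"
  obtains j where "a = g ^ j"
proof -
  have "a \<in> range (\<lambda>k::nat. g ^ k)"
    using assms range_power_g by simp
  then show ?thesis using that by auto
qed

text \<open>If \<open>d\<close> is the least positive exponent with \<open>g ^ d = 1\<close>, then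
  the first \<open>d\<close> powers are distinct and exhaust the \<open>n\<close> non-zero elements,
  so \<open>d = n\<close>.\<close>

lemma power_g_eq_1_iff: "g ^ m = 1 \<longleftrightarrow> n dvd m"
proof -
  have "\<not> inj (\<lambda>k::nat. g ^ k)"
    using finite_imageD[of "\<lambda>k::nat. g ^ k" UNIV] infinite_UNIV_nat by auto
  then obtain i j :: nat where ij: "i < j" "g ^ i = g ^ j"
    unfolding inj_def by (metis nat_neq_iff)
  then have "g ^ i * g ^ (j - i) = g ^ i * 1"
    by (metis less_imp_le le_add_diff_inverse mult_1_right power_add)
  then have "g ^ (j - i) = 1" by simp
  then have ex: "\<exists>d>0. g ^ d = 1" using ij by (intro exI[of _ "j - i"]) auto
  define d where "d = (LEAST d. d > 0 \<and> g ^ d = 1)"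
  have d: "d > 0" "g ^ d = 1"
    using LeastI_ex[OF ex] unfolding d_def by auto
  have least: "d \<le> e" if "e > 0" "g ^ e = 1" for e
    unfolding d_def using that by (intro Least_le) auto
  have red: "g ^ k = g ^ (k mod d)" for k
  proof -
    have "g ^ k = g ^ (d * (k div d) + k mod d)" by (simp only: mult_div_mod_eq)
    also have "\<dots> = g ^ (k mod d)" by (simp only: power_add power_mult d power_one mult_1)
    finally show ?thesis .
  qed
  have "range (\<lambda>k::nat. g ^ k) = (\<lambda>k. g ^ k) ` {..<d}"
  proof (rule equalityI; rule subsetI)
    fix x assume "x \<in> range (\<lambda>k::nat. g ^ k)"
    then obtain k where "x = g ^ k" by auto
    then show "x \<in> (\<lambda>k. g ^ k) ` {..<d}"
      using red[of k] d by (intro image_eqI[of _ _ "k mod d"]) auto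
  qed auto
  moreover have "inj_on (\<lambda>k. g ^ k) {..<d}"
  proof (rule linorder_inj_onI)
    fix i j assume "i < j" "i \<in> {..<d}" "j \<in> {..<d}"
    show "g ^ i \<noteq> g ^ j"
    proof
      assume "g ^ i = g ^ j"
      with \<open>i < j\<close> have "g ^ i * g ^ (j - i) = g ^ i * 1"
        by (metis less_imp_le le_add_diff_inverse mult_1_right power_add)
      then have "g ^ (j - i) = 1" by simp
      then show False using least[of "j - i"] \<open>i < j\<close> \<open>j \<in> {..<d}\<close> by auto
    qed
  qed auto
  ultimately have "n = d"
    by (metis card_image card_lessThan n_def range_power_g)
  moreover have "g ^ m = 1 \<longleftrightarrow> d dvd m"
  proof
    assume "g ^ m = 1"
    then show "d dvd m" using red[of m] least[of "m mod d"] d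
      by (metis dvd_eq_mod_eq_0 linorder_not_le mod_less_divisor neq0_conv)
  next
    assume "d dvd m"
    then show "g ^ m = 1" using d by (auto simp: power_mult elim!: dvdE)
  qed
  ultimately show ?thesis by simp
qed

lemma power_g_eq_iff: "g ^ i = g ^ j \<longleftrightarrow> [i = j] (mod n)"
proof -
  have *: "g ^ i = g ^ j \<longleftrightarrow> [i = j] (mod n)" if "i \<le> j" for i j
  proof -
    have "g ^ j = g ^ i * g ^ (j - i)" using that by (simp flip: power_add)
    then have "g ^ i = g ^ j \<longleftrightarrow> g ^ (j - i) = 1" by simp
    also have "\<dots> \<longleftrightarrow> [j = i] (mod n)"
      using that by (simp add: power_g_eq_1_iff cong_altdef_nat)
    finally show ?thesis by (simp only: cong_sym_eq)
  qed
  show ?thesis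
    using *[of i j] *[of j i] by (metis cong_sym_eq linear)
qed

lemma bij_betw_power_g: "bij_betw (\<lambda>j. g ^ j) {..<n} (UNIV - {0})"
proof (rule bij_betw_imageI)
  show "inj_on (\<lambda>j. g ^ j) {..<n}"
    by (rule inj_onI) (simp only: power_g_eq_iff cong_less_modulus_unique_nat lessThan_iff)
  show "(\<lambda>j. g ^ j) ` {..<n} = UNIV - {0}"
  proof (rule equalityI; rule subsetI)
    fix x :: 'a assume "x \<in> UNIV - {0}"
    then obtain j where "x = g ^ j" using ex_power_g by auto
    moreover have "g ^ j = g ^ (j mod n)"
      by (simp only: power_g_eq_iff cong_mod_right cong_refl)
    ultimately show "x \<in> (\<lambda>j. g ^ j) ` {..<n}"
      using n_pos by (intro image_eqI[of _ _ "j mod n"]) auto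
  qed auto
qed

lemma sum_field_eq:
  fixes F :: "'a \<Rightarrow> 'b::comm_monoid_add"
  assumes "F 0 = 0"
  shows "(\<Sum>a\<in>UNIV. F a) = (\<Sum>j<n. F (g ^ j))"
proof -
  have "(\<Sum>a\<in>UNIV. F a) = (\<Sum>a\<in>UNIV - {0}. F a)"
    using assms by (intro sum.mono_neutral_right) auto
  also have "\<dots> = (\<Sum>j<n. F (g ^ j))"
    by (rule sum.reindex_bij_betw [OF bij_betw_power_g, symmetric])
  finally show ?thesis .
qed

text \<open>\<open>g ^ j\<close> generates exactly if \<open>g\<close> is one of its powers, that
  is, if \<open>j\<close> is invertible modulo \<open>n\<close>.\<close>

lemma primitive_power_g_iff: "primitive_elem (g ^ j) \<longleftrightarrow> coprime j n"
proof
  assume "primitive_elem (g ^ j)"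
  then have "g \<in> range (\<lambda>k::nat. (g ^ j) ^ k)"
    by (simp add: primitive_elem_def)
  then obtain k where "g ^ 1 = g ^ (j * k)"
    by (auto simp: power_mult)
  then have "[j * k = 1] (mod n)"
    by (simp only: power_g_eq_iff cong_sym_eq)
  then show "coprime j n"
    by (metis coprime_iff_invertible_nat One_nat_def)
next
  assume "coprime j n"
  then obtain k where "[j * k = 1] (mod n)"
    by (metis coprime_iff_invertible_nat One_nat_def)
  then have k: "g ^ (j * k) = g"
    using power_g_eq_iff[of "j * k" 1] by simp
  have "x \<in> range (\<lambda>i::nat. (g ^ j) ^ i)" if "x \<noteq> 0" for x
  proof -
    obtain i where "x = g ^ i" using ex_power_g \<open>x \<noteq> 0\<close> by auto
    also have "\<dots> = (g ^ j) ^ (k * i)" by (metis k power_mult)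
    finally show ?thesis by blast
  qed
  then show "primitive_elem (g ^ j)"
    by (auto simp: primitive_elem_def)
qed

text \<open>The chosen logarithm is determined only modulo \<open>n\<close>, which does not affect
  the power of \<open>zeta n\<close>. The trivial character also vanishes at 0, so
  \<open>a = 0\<close>, where \<open>inverse a = 0\<close>, never contributes to the sums
  below.\<close>

definition chi :: "nat \<Rightarrow> 'a \<Rightarrow> complex" where
  "chi k a = (if a = 0 then 0 else zeta n ^ (k * (SOME j. g ^ j = a)))"

lemma chi_zero [simp]: "chi k 0 = 0"
  by (simp add: chi_def)

lemma chi_power_g: "chi k (g ^ j) = zeta n ^ (k * j)"
proof -
  have "g ^ (SOME i. g ^ i = g ^ j) = g ^ j"
    by (rule someI) (rule refl)
  then have "[k * (SOME i. g ^ i = g ^ j) = k * j] (mod n)"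
    by (simp only: power_g_eq_iff cong_scalar_left)
  then show ?thesis
    using zeta_power_cong[OF n_pos] by (simp add: chi_def)
qed

lemma chi_mult: "chi k (a * b) = chi k a * chi k b"
proof (cases "a = 0 \<or> b = 0")
  case False
  then obtain i j where "a = g ^ i" "b = g ^ j"
    by (metis ex_power_g)
  then show ?thesis
    by (simp add: chi_power_g add_mult_distrib2 flip: power_add)
qed auto

lemma chi_one [simp]: "chi k 1 = 1"
  using chi_power_g[of k 0] by simp

lemma norm_chi: "norm (chi k a) = (if a = 0 then 0 else 1)"
  by (simp add: chi_def norm_power)

lemma norm_chi_le: "norm (chi k a) \<le> 1"
  by (simp add: norm_chi)

lemma chi_add: "chi (k + l) a = chi k a * chi l a"
  by (simp add: chi_def add_mult_distrib power_add)

lemma chi_cong: "[k = l] (mod n) \<Longrightarrow> chi k a = chi l a"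
  using n_pos by (auto simp: chi_def intro!: zeta_power_cong cong_scalar_right)

lemma chi_trivial: "n dvd k \<Longrightarrow> chi k a = of_bool (a \<noteq> 0)"
  using n_pos by (simp add: chi_def zeta_power_eq_1_iff)

lemma chi_mult_cnj: "chi k a * cnj (chi k a) = of_bool (a \<noteq> 0)"
  by (simp add: complex_norm_square [symmetric] norm_chi)

lemma chi_inverse: "chi k (inverse a) = cnj (chi k a)"
proof (cases "a = 0")
  case False
  then have "chi k a * chi k (inverse a) = chi k a * cnj (chi k a)"
    by (simp add: chi_mult_cnj flip: chi_mult)
  moreover have "chi k a \<noteq> 0" using False norm_chi[of k a] by auto
  ultimately show ?thesis by simp
qed simp

text \<open>Inverse characters get the index \<open>n - k\<close>, which keeps all indices natural
  numbers.\<close>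

lemma chi_inverse':
  assumes "k \<le> n"
  shows "chi k (inverse a) = chi (n - k) a"
proof (cases "a = 0")
  case False
  then have "chi k a * chi k (inverse a) = 1"
    by (simp flip: chi_mult)
  moreover have "chi k a * chi (n - k) a = 1"
    using False assms chi_trivial[of n a] by (simp flip: chi_add)
  ultimately show ?thesis by (metis mult_left_cancel mult_zero_left zero_neq_one)
qed simp

lemma sum_chi: "(\<Sum>a\<in>UNIV. chi k a) = (if n dvd k then of_nat n else 0)"
  using sum_zeta_power[OF n_pos, of k]
  by (subst sum_field_eq) (simp_all only: chi_zero chi_power_g mult.commute[of k])

section \<open>Jacobi sums and their absolute values\<close>

definition jacobi :: "nat \<Rightarrow> nat \<Rightarrow> complex" where
  "jacobi k l = (\<Sum>a\<in>UNIV. chi k a * chi l (1 - a))"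

lemma sum_field_mult:
  fixes F :: "'a \<Rightarrow> 'b::comm_monoid_add"
  assumes "b \<noteq> 0"
  shows "(\<Sum>a\<in>UNIV. F (b * a)) = (\<Sum>a\<in>UNIV. F a)"
  by (rule sum.reindex_bij_witness[of _ "\<lambda>a. a / b" "\<lambda>a. b * a"]) (use assms in auto)

text \<open>For \<open>t \<noteq> 1\<close> the Moebius map \<open>b \<mapsto> (1 - bt) / (1 - b)\<close> is a bijection from the complement of
  \<open>1\<close> to the complement of \<open>t\<close>.\<close>

lemma sum_chi_moebius:
  assumes "\<not> n dvd l"
  shows "(\<Sum>b\<in>UNIV - {0}. chi l (1 - b * t) * cnj (chi l (1 - b)))
       = of_bool (t = 1) * (of_nat n + 1) - chi l t - 1"
proof -
  have split: "(\<Sum>b\<in>UNIV - {0}. chi l (1 - b * t) * cnj (chi l (1 - b)))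
      = (\<Sum>b\<in>UNIV. chi l (1 - b * t) * cnj (chi l (1 - b))) - 1"
    by (subst sum.remove[of UNIV 0]) auto
  show ?thesis
  proof (cases "t = 1")
    case True
    have "(\<Sum>b\<in>UNIV. chi l (1 - b * t) * cnj (chi l (1 - b))) = (\<Sum>b\<in>UNIV. of_bool (b \<noteq> (1::'a)))"
      using True by (intro sum.cong) (auto simp: chi_mult_cnj)
    also have "\<dots> = of_nat (card (UNIV - {1::'a}))"
      by (simp add: Compl_eq_Diff_UNIV [symmetric] Collect_neg_eq)
    also have "card (UNIV - {1::'a}) = n" by (simp add: n_def)
    finally show ?thesis using True unfolding split by simp
  next
    case False
    have "(\<Sum>b\<in>UNIV. chi l (1 - b * t) * cnj (chi l (1 - b)))
        = (\<Sum>b\<in>UNIV - {1}. chi l ((1 - b * t) / (1 - b)))"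
      by (subst sum.remove[of UNIV 1]) (simp_all add: divide_inverse chi_mult chi_inverse)
    also have "\<dots> = (\<Sum>y\<in>UNIV - {t}. chi l y)"
    \<comment> \<open>The inverse map comes from solving \<open>y * (1 - b) = 1 - b * t\<close> for
      \<open>b\<close>.\<close>
    proof (rule sum.reindex_bij_witness[of _ "\<lambda>y. (y - 1) / (y - t)" "\<lambda>b. (1 - b * t) / (1 - b)"])
      fix b :: 'a assume "b \<in> UNIV - {1}"
      then have b: "1 - b \<noteq> 0" by auto
      have y: "(1 - b * t) / (1 - b) - t = (1 - t) / (1 - b)"
        using b by (simp add: field_simps)
      have y': "(1 - b * t) / (1 - b) - 1 = b * (1 - t) / (1 - b)"
        using b by (simp add: field_simps)
      show "((1 - b * t) / (1 - b) - 1) / ((1 - b * t) / (1 - b) - t) = b"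
        unfolding y y' using b False by simp
      have "(1 - b * t) / (1 - b) - t \<noteq> 0" unfolding y using b False by simp
      then show "(1 - b * t) / (1 - b) \<in> UNIV - {t}" by auto
    next
      fix y assume "y \<in> UNIV - {t}"
      then have y: "y - t \<noteq> 0" by auto
      have b: "1 - (y - 1) / (y - t) = (1 - t) / (y - t)"
        using y by (simp add: field_simps)
      have b': "1 - (y - 1) / (y - t) * t = y * (1 - t) / (y - t)"
        using y by (simp add: field_simps)
      show "(1 - (y - 1) / (y - t) * t) / (1 - (y - 1) / (y - t)) = y"
        unfolding b b' using y False by simp
      have "1 - (y - 1) / (y - t) \<noteq> 0" unfolding b using y False by simp
      then show "(y - 1) / (y - t) \<in> UNIV - {1}" by auto
    qed simp
    also have "\<dots> = (\<Sum>y\<in>UNIV. chi l y) - chi l t"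
      by (subst sum.remove[of UNIV t]) auto
    finally show ?thesis using False assms unfolding split by (simp add: sum_chi)
  qed
qed

text \<open>Expand the square and substitute \<open>a = b * t\<close>; the sum over \<open>b\<close>
  is then a Moebius sum. Its diagonal part \<open>t = 1\<close> yields \<open>n + 1\<close>, and
  what remains are complete sums of the characters \<open>k + l\<close> and \<open>k\<close>,
  non-zero only if these are trivial.\<close>

lemma norm_jacobi_square:
  assumes "\<not> n dvd l"
  shows "(norm (jacobi k l))\<^sup>2
       = real n + 1 - (if n dvd k then real n else 0) - (if n dvd (k + l) then real n else 0)"
proof -
  let ?h = "\<lambda>a b. chi k a * chi l (1 - a) * cnj (chi k b * chi l (1 - b))"
  have inner: "(\<Sum>a\<in>UNIV. ?h a b) = (\<Sum>t\<in>UNIV. chi k t * (chi l (1 - b * t) * cnj (chi l (1 - b))))"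
    if "b \<noteq> 0" for b
  proof -
    have "(\<Sum>a\<in>UNIV. ?h a b) = (\<Sum>t\<in>UNIV. ?h (b * t) b)"
      using sum_field_mult[OF that, of "\<lambda>a. ?h a b"] by simp
    also have "\<dots> = (\<Sum>t\<in>UNIV. (chi k b * cnj (chi k b)) * (chi k t * (chi l (1 - b * t) * cnj (chi l (1 - b)))))"
      by (simp add: chi_mult mult_ac)
    also have "chi k b * cnj (chi k b) = 1" using that by (simp add: chi_mult_cnj)
    finally show ?thesis by simp
  qed
  have "complex_of_real ((norm (jacobi k l))\<^sup>2) = (\<Sum>b\<in>UNIV. \<Sum>a\<in>UNIV. ?h a b)"
    unfolding complex_norm_square jacobi_def cnj_sum
    by (subst sum_product, subst sum.swap) simp
  also have "\<dots> = (\<Sum>b\<in>UNIV - {0}. \<Sum>a\<in>UNIV. ?h a b)"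
    by (rule sum.mono_neutral_right) auto
  also have "\<dots> = (\<Sum>b\<in>UNIV - {0}. \<Sum>t\<in>UNIV. chi k t * (chi l (1 - b * t) * cnj (chi l (1 - b))))"
    by (intro sum.cong refl inner) auto
  also have "\<dots> = (\<Sum>t\<in>UNIV. chi k t * (\<Sum>b\<in>UNIV - {0}. chi l (1 - b * t) * cnj (chi l (1 - b))))"
    by (subst sum.swap) (simp only: sum_distrib_left)
  also have "\<dots> = (\<Sum>t\<in>UNIV. of_bool (t = 1) * (of_nat n + 1) - chi (k + l) t - chi k t)"
    unfolding sum_chi_moebius[OF assms]
    by (intro sum.cong refl) (auto simp: chi_add algebra_simps)
  also have "\<dots> = (\<Sum>t\<in>UNIV. of_bool (t = (1::'a)) * (of_nat n + 1)) - (\<Sum>t\<in>UNIV. chi (k + l) t) - (\<Sum>t\<in>UNIV. chi k t)"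
    by (simp only: sum_subtractf)
  also have "(\<Sum>t\<in>UNIV. of_bool (t = (1::'a)) * (of_nat n + 1 :: complex)) = of_nat n + 1"
    by (simp flip: sum_distrib_right)
  also have "of_nat n + 1 - (\<Sum>t\<in>UNIV. chi (k + l) t) - (\<Sum>t\<in>UNIV. chi k t)
      = complex_of_real (real n + 1 - (if n dvd k then real n else 0) - (if n dvd (k + l) then real n else 0))"
    by (simp add: sum_chi)
  finally show ?thesis by (simp only: of_real_eq_iff)
qed

text \<open>\<open>g ^ (n div 2)\<close> is a square root of 1 other than 1, hence equals
  -1.\<close>

lemma chi_minus_one:
  assumes "even n"
  shows "chi k (-1) = (-1) ^ k"
proof -
  have "(g ^ (n div 2))\<^sup>2 = 1"
    using assms power_g_eq_1_iff[of n] by (simp flip: power_mult)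
  moreover have "\<not> n dvd n div 2"
    using assms n_pos by (auto dest!: dvd_imp_le)
  then have "g ^ (n div 2) \<noteq> 1"
    by (simp add: power_g_eq_1_iff)
  ultimately have "-1 = g ^ (n div 2)" by (auto simp: power2_eq_1_iff)
  then have "chi k (-1) = (zeta n ^ (n div 2)) ^ k"
    by (simp only: chi_power_g mult.commute[of k] power_mult)
  then show ?thesis using assms n_pos by (simp add: zeta_power_half)
qed

text \<open>For \<open>b \<noteq> 0\<close> the last factor is the number of square roots of
  \<open>b\<close>: squaring is bijective for odd \<open>n\<close>, and \<open>chi (n div 2)\<close>
  is the quadratic character for even \<open>n\<close>.\<close>

lemma sum_squares:
  fixes F :: "'a \<Rightarrow> complex"
  assumes "F 0 = 0"
  shows "(\<Sum>a\<in>UNIV. F (a\<^sup>2)) = (\<Sum>b\<in>UNIV. F b * (if even n then 1 + chi (n div 2) b else 1))"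
proof -
  let ?R = "\<lambda>b. F b * (if even n then 1 + chi (n div 2) b else 1)"
  have L: "(\<Sum>a\<in>UNIV. F (a\<^sup>2)) = (\<Sum>j<n. F (g ^ (2 * j)))"
    using assms by (subst sum_field_eq) (simp_all flip: power_mult add: mult.commute)
  have R: "(\<Sum>b\<in>UNIV. ?R b) = (\<Sum>j<n. ?R (g ^ j))"
    using assms by (subst sum_field_eq) simp_all
  show ?thesis
  proof (cases "even n")
    case False
    have inj: "inj_on (\<lambda>j. (2 * j) mod n) {..<n}"
    proof (rule inj_onI)
      fix i j assume ij: "i \<in> {..<n}" "j \<in> {..<n}" "(2 * i) mod n = (2 * j) mod n"
      have "coprime 2 n" using False by simp
      then have "[i = j] (mod n)"
        using ij cong_mult_lcancel_nat[of 2 n i j] by (simp add: cong_def)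
      then show "i = j" using ij by (simp add: cong_less_modulus_unique_nat)
    qed
    moreover have "(\<lambda>j. (2 * j) mod n) ` {..<n} \<subseteq> {..<n}" using n_pos by auto
    ultimately have "bij_betw (\<lambda>j. (2 * j) mod n) {..<n} {..<n}"
      by (simp add: bij_betw_def endo_inj_surj)
    then have "(\<Sum>j<n. F (g ^ ((2 * j) mod n))) = (\<Sum>j<n. F (g ^ j))"
      by (rule sum.reindex_bij_betw)
    moreover have "g ^ ((2 * j) mod n) = g ^ (2 * j)" for j
      by (simp only: power_g_eq_iff cong_mod_left cong_refl)
    ultimately show ?thesis unfolding L R using False by simp
  next
    case True
    define h where "h = n div 2"
    have n2: "n = 2 * h" using True by (simp add: h_def)
    have chi_h: "chi h (g ^ j) = (-1) ^ j" for j
      using zeta_power_half[OF n_pos True] by (simp add: chi_power_g h_def power_mult)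
    \<comment> \<open>The exponents \<open>j\<close> and \<open>j + h\<close> belong to the two
      square roots of one element, so both halves of the range contribute equally.\<close>
    have shift: "g ^ (2 * (j + h)) = g ^ (2 * j)" for j
      by (simp add: power_g_eq_iff cong_def n2 add_mult_distrib2)
    have "(\<Sum>j<n. F (g ^ (2 * j))) = (\<Sum>j<h. F (g ^ (2 * j))) + (\<Sum>j=h..<2*h. F (g ^ (2 * j)))"
      unfolding n2 lessThan_atLeast0 by (rule sum.atLeastLessThan_concat [symmetric]) auto
    also have "(\<Sum>j=h..<2*h. F (g ^ (2 * j))) = (\<Sum>j<h. F (g ^ (2 * (j + h))))"
      unfolding lessThan_atLeast0 using sum.shift_bounds_nat_ivl[of "\<lambda>j. F (g ^ (2 * j))" 0 h h]
      by (simp add: mult_2)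
    finally have "(\<Sum>j<n. F (g ^ (2 * j))) = 2 * (\<Sum>j<h. F (g ^ (2 * j)))"
      by (simp only: shift mult_2 [of "sum _ _"])
    moreover have "(\<Sum>j<n. ?R (g ^ j)) = (\<Sum>j<2*h. if even j then 2 * F (g ^ j) else 0)"
    proof (rule sum.cong)
      show "?R (g ^ j) = (if even j then 2 * F (g ^ j) else 0)" for j
        using True unfolding h_def [symmetric] chi_h by simp
    qed (simp add: n2)
    moreover have "\<dots> = (\<Sum>j<h. 2 * F (g ^ (2 * j)))"
      by (induction h) simp_all
    ultimately show ?thesis unfolding L R by (simp add: sum_distrib_left)
  qed
qed

end

section \<open>Character sums over quadratic polynomials\<close>

locale field_generator_uv = field_generator +
  fixes u v :: 'a
  assumes u: "u \<noteq> 0" and v: "v \<noteq> 0"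
begin

definition linear_sum :: "nat \<Rightarrow> nat \<Rightarrow> complex" where
  "linear_sum m k = (\<Sum>b\<in>UNIV. chi m b * chi k (u * b + v))"

definition quadratic_sum :: "nat \<Rightarrow> nat \<Rightarrow> complex" where
  "quadratic_sum m k = (\<Sum>a\<in>UNIV. chi m a * chi k (u * a\<^sup>2 + v))"

definition mixed_sum :: "nat \<Rightarrow> nat \<Rightarrow> complex" where
  "mixed_sum k l = (\<Sum>a\<in>UNIV. chi k a * chi l (u * a + v * inverse a))"

text \<open>Substituting \<open>b = - (v / u) * c\<close> turns \<open>u * b + v\<close> into
  \<open>v * (1 - c)\<close> and leaves a factor of absolute value 1.\<close>

lemma norm_linear_sum: "norm (linear_sum m k) = norm (jacobi m k)"
proof -
  let ?w = "- (v / u)"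
  have "linear_sum m k = (\<Sum>c\<in>UNIV. chi m (?w * c) * chi k (u * (?w * c) + v))"
    unfolding linear_sum_def using u v by (subst sum_field_mult) auto
  also have "\<dots> = (\<Sum>c\<in>UNIV. (chi m ?w * chi k v) * (chi m c * chi k (1 - c)))"
  proof (intro sum.cong refl)
    fix c
    have "u * (?w * c) + v = v * (1 - c)" using u by (simp add: field_simps)
    then show "chi m (?w * c) * chi k (u * (?w * c) + v)
        = (chi m ?w * chi k v) * (chi m c * chi k (1 - c))"
      by (simp only: chi_mult mult_ac)
  qed
  also have "\<dots> = (chi m ?w * chi k v) * jacobi m k"
    by (simp only: jacobi_def sum_distrib_left)
  finally show ?thesis using u v by (simp add: norm_mult norm_chi)
qed

lemma norm_linear_sum_le:
  assumes "\<not> n dvd k"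
  shows "norm (linear_sum m k) \<le> sqrt (real n + 1)"
  using norm_jacobi_square[OF assms, of m]
  by (intro real_le_rsqrt) (auto simp: norm_linear_sum)

text \<open>The degenerate Jacobi sums: exactly one of the two terms \<open>n\<close> is subtracted
  from \<open>n + 1\<close>.\<close>

lemma norm_linear_sum_le_1:
  assumes "\<not> n dvd k" "n dvd m \<or> n dvd m + k"
  shows "norm (linear_sum m k) \<le> 1"
proof -
  have "(norm (jacobi m k))\<^sup>2 \<le> 1\<^sup>2"
    using norm_jacobi_square[OF assms(1), of m] assms by auto
  then show ?thesis
    unfolding norm_linear_sum by (rule power2_le_imp_le) simp
qed

text \<open>A character of even index at \<open>a\<close> is a character at the square of
  \<open>a\<close>, so the summand depends on that square only.\<close>

lemma quadratic_sum_double: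
  "quadratic_sum (2 * m) k = linear_sum m k + (if even n then linear_sum (m + n div 2) k else 0)"
proof -
  have "quadratic_sum (2 * m) k = (\<Sum>a\<in>UNIV. chi m (a\<^sup>2) * chi k (u * a\<^sup>2 + v))"
    by (simp add: quadratic_sum_def mult_2 chi_add power2_eq_square chi_mult)
  also have "\<dots> = (\<Sum>b\<in>UNIV. chi m b * chi k (u * b + v) * (if even n then 1 + chi (n div 2) b else 1))"
    by (rule sum_squares) simp
  also have "\<dots> = linear_sum m k + (if even n then linear_sum (m + n div 2) k else 0)"
    by (simp add: linear_sum_def chi_add algebra_simps sum.distrib)
  finally show ?thesis .
qed

text \<open>The substitution of \<open>-a\<close> for \<open>a\<close> changes the sign of an odd
  character only.\<close>

lemma quadratic_sum_odd:
  assumes "even n" "odd m"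
  shows "quadratic_sum m k = 0"
proof -
  have "quadratic_sum m k = (\<Sum>a\<in>UNIV. chi m (-1 * a) * chi k (u * (-1 * a)\<^sup>2 + v))"
    unfolding quadratic_sum_def by (subst sum_field_mult) auto
  also have "\<dots> = - quadratic_sum m k"
    unfolding quadratic_sum_def chi_mult chi_minus_one[OF assms(1)]
    using assms by (simp add: sum_negf)
  finally show ?thesis by simp
qed

lemma quadratic_sum_cong: "[m = m'] (mod n) \<Longrightarrow> quadratic_sum m k = quadratic_sum m' k"
  unfolding quadratic_sum_def by (simp only: chi_cong)

lemma norm_quadratic_sum_double_le:
  assumes "\<not> n dvd k"
  shows "norm (quadratic_sum (2 * m) k) \<le> 2 * sqrt (real n + 1)"
  using norm_linear_sum_le[OF assms, of m] norm_linear_sum_le[OF assms, of "m + n div 2"]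
    norm_triangle_ineq[of "linear_sum m k" "linear_sum (m + n div 2) k"]
    norm_ge_zero[of "linear_sum (m + n div 2) k"]
  unfolding quadratic_sum_double
  by (cases "even n"; simp only: if_True if_False add_0_right simp_thms; linarith)

lemma norm_quadratic_sum_le:
  assumes "\<not> n dvd k"
  shows "norm (quadratic_sum m k) \<le> 2 * sqrt (real n + 1)"
proof (cases "even m")
  case True
  then show ?thesis using norm_quadratic_sum_double_le[OF assms] by (auto elim!: evenE)
next
  case m: False
  show ?thesis
  proof (cases "even n")
    case True
    then show ?thesis using quadratic_sum_odd[OF True m] by simp
  next
    case False
    \<comment> \<open>For odd \<open>n\<close>, adding \<open>n\<close> makes the odd index even
      without changing the character.\<close>
    have "quadratic_sum m k = quadratic_sum (m + n) k"
      by (rule quadratic_sum_cong) (simp add: cong_def)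
    moreover have "m + n = 2 * ((m + n) div 2)" using False m by simp
    ultimately show ?thesis using norm_quadratic_sum_double_le[OF assms] by metis
  qed
qed

text \<open>The first of the two linear sums is degenerate here.\<close>

lemma norm_quadratic_sum_double_le':
  assumes "\<not> n dvd k" "n dvd m \<or> n dvd m + k"
  shows "norm (quadratic_sum (2 * m) k) \<le> 1 + sqrt (real n + 1)"
  using norm_linear_sum_le_1[OF assms] norm_linear_sum_le[OF assms(1), of "m + n div 2"]
    norm_triangle_ineq[of "linear_sum m k" "linear_sum (m + n div 2) k"]
    norm_ge_zero[of "linear_sum (m + n div 2) k"]
  unfolding quadratic_sum_double
  by (cases "even n"; simp only: if_True if_False add_0_right simp_thms; linarith)

text \<open>Factor \<open>inverse a\<close> out of the second argument; the character
  \<open>l\<close> at \<open>inverse a\<close> is the character \<open>n - l\<close> at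
  \<open>a\<close>.\<close>

lemma mixed_sum_eq:
  assumes "l \<le> n"
  shows "mixed_sum k l = quadratic_sum (k + (n - l)) l"
  unfolding mixed_sum_def quadratic_sum_def
proof (intro sum.cong refl)
  fix a
  show "chi k a * chi l (u * a + v * inverse a) = chi (k + (n - l)) a * chi l (u * a\<^sup>2 + v)"
  proof (cases "a = 0")
    case False
    then have "u * a + v * inverse a = (u * a\<^sup>2 + v) * inverse a"
      by (simp add: field_simps power2_eq_square)
    then show ?thesis
      by (simp only: chi_mult chi_inverse'[OF assms] chi_add mult_ac)
  qed simp
qed

lemma norm_mixed_sum_le:
  assumes "l \<in> {1..<n}"
  shows "norm (mixed_sum k l) \<le> 2 * sqrt (real n + 1)"
proof -
  have "\<not> n dvd l" using assms by (auto dest: dvd_imp_le)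
  then show ?thesis using assms norm_quadratic_sum_le[of l] by (simp add: mixed_sum_eq)
qed

text \<open>The index \<open>l + (n - l)\<close> is 0 modulo \<open>n\<close>, written
  \<open>2 * 0\<close> to match \<open>quadratic_sum_double\<close>.\<close>

lemma mixed_sum_diag_eq:
  assumes "l \<le> n"
  shows "mixed_sum l l = quadratic_sum (2 * 0) l"
  using assms by (simp add: mixed_sum_eq) (rule quadratic_sum_cong, simp add: cong_def)

lemma norm_mixed_sum_diag_le:
  assumes "l \<in> {1..<n}"
  shows "norm (mixed_sum l l) \<le> 1 + sqrt (real n + 1)"
proof -
  have "\<not> n dvd l" using assms by (auto dest: dvd_imp_le)
  then show ?thesis
    using assms norm_quadratic_sum_double_le'[of l 0] mixed_sum_diag_eq[of l] by auto
qed

text \<open>The index is \<open>2 * m\<close> with \<open>m = n - l\<close>, and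
  \<open>m + l = n\<close> makes the first linear sum degenerate.\<close>

lemma norm_mixed_sum_antidiag_le:
  assumes "l \<in> {1..<n}"
  shows "norm (mixed_sum (n - l) l) \<le> 1 + sqrt (real n + 1)"
proof -
  have "\<not> n dvd l" using assms by (auto dest: dvd_imp_le)
  then show ?thesis
    using assms norm_quadratic_sum_double_le'[of l "n - l"] mixed_sum_eq[of l "n - l"]
    by (auto simp: mult_2)
qed

text \<open>For the quadratic character the diagonal and the antidiagonal coincide, and both linear
  sums are degenerate.\<close>

lemma norm_mixed_sum_half_le:
  assumes "n = 2 * l"
  shows "norm (mixed_sum l l) \<le> 2"
proof -
  have l: "l > 0" "\<not> n dvd l" using assms n_pos by (auto dest: dvd_imp_le)
  have "mixed_sum l l = linear_sum 0 l + linear_sum l l"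
    using mixed_sum_diag_eq[of l] assms quadratic_sum_double[of 0 l] by simp
  moreover have "norm (linear_sum 0 l) \<le> 1" "norm (linear_sum l l) \<le> 1"
    using assms by (intro norm_linear_sum_le_1 l; simp add: mult_2)+
  ultimately show ?thesis
    using norm_triangle_ineq[of "linear_sum 0 l" "linear_sum l l"] by simp
qed

text \<open>The case \<open>q = 3\<close>: the quadratic sum has index 1, which is odd.\<close>

lemma mixed_sum_0_1:
  assumes "n = 2"
  shows "mixed_sum 0 1 = 0"
  using mixed_sum_eq[of 1 0] quadratic_sum_odd[of 1 1] assms by simp

lemma unit_mult_eq_0_iff:
  assumes "a \<noteq> 0"
  shows "u * a + v * inverse a = 0 \<longleftrightarrow> u * a\<^sup>2 + v = 0"
proof -
  have "u * a\<^sup>2 + v = (u * a + v * inverse a) * a"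
    using assms by (simp add: field_simps power2_eq_square)
  then show ?thesis using assms by simp
qed

text \<open>The trivial character detects \<open>u * a + v * inverse a \<noteq> 0\<close>. This is
  how the zeros of \<open>u * x ^ 2 + v\<close> enter the estimate.\<close>

lemma mixed_sum_trivial:
  "mixed_sum k 0 = (\<Sum>a\<in>UNIV. chi k a) - (\<Sum>a | u * a\<^sup>2 + v = 0. chi k a)"
proof -
  have "mixed_sum k 0 = (\<Sum>a\<in>UNIV. if u * a\<^sup>2 + v = 0 then 0 else chi k a)"
    unfolding mixed_sum_def
  proof (intro sum.cong refl)
    fix a
    show "chi k a * chi 0 (u * a + v * inverse a) = (if u * a\<^sup>2 + v = 0 then 0 else chi k a)"
      using unit_mult_eq_0_iff[of a] by (cases "a = 0") (auto simp: chi_trivial)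
  qed
  also have "\<dots> = (\<Sum>a\<in>UNIV. chi k a - (if u * a\<^sup>2 + v = 0 then chi k a else 0))"
    by (intro sum.cong) auto
  also have "\<dots> = (\<Sum>a\<in>UNIV. chi k a) - (\<Sum>a | u * a\<^sup>2 + v = 0. chi k a)"
    by (simp add: sum_subtractf sum.If_cases Int_def)
  finally show ?thesis .
qed

lemma norm_mixed_sum_trivial_le:
  assumes "k \<in> {1..<n}"
  shows "norm (mixed_sum k 0) \<le> real (card {a. u * a\<^sup>2 + v = 0})"
proof -
  have "\<not> n dvd k" using assms by (auto dest: dvd_imp_le)
  then have "norm (mixed_sum k 0) = norm (\<Sum>a | u * a\<^sup>2 + v = 0. chi k a)"
    by (simp add: mixed_sum_trivial sum_chi)
  also have "\<dots> \<le> (\<Sum>a | u * a\<^sup>2 + v = 0. 1)"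
    by (intro sum_norm_le norm_chi_le)
  finally show ?thesis by simp
qed

lemma mixed_sum_0_0: "mixed_sum 0 0 = of_real (real n - real (card {a. u * a\<^sup>2 + v = 0}))"
proof -
  \<comment> \<open>Since \<open>v \<noteq> 0\<close>, the point 0, where \<open>chi 0\<close>
    vanishes, is not among the zeros.\<close>
  have "(\<Sum>a | u * a\<^sup>2 + v = 0. chi 0 a) = (\<Sum>a | u * a\<^sup>2 + v = 0. 1)"
    using v by (intro sum.cong) (auto simp: chi_trivial)
  then show ?thesis by (simp add: mixed_sum_trivial sum_chi)
qed

section \<open>Expansion of the count in character sums, and its estimate\<close>

lemma of_bool_primitive_elem:
  "of_bool (primitive_elem a) = (\<Sum>k<n. ramanujan_coeff n k * cnj (chi k a))"
proof (cases "a = 0")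
  case True
  then show ?thesis by (simp add: primitive_elem_def)
next
  case False
  then obtain j where "j < n" and a: "a = g ^ j"
    using bij_betw_power_g by (auto simp: bij_betw_def image_iff set_eq_iff)
  have "(\<Sum>k<n. ramanujan_coeff n k * cnj (chi k a))
      = (\<Sum>k<n. dft n (\<lambda>j. of_bool (coprime j n)) k * cnj (zeta n ^ (k * j))) / of_nat n"
    by (simp add: a chi_power_g ramanujan_coeff_def sum_divide_distrib)
  \<comment> \<open>Fourier inversion at the discrete logarithm \<open>j\<close> of
    \<open>a\<close>.\<close>
  also have "\<dots> = of_bool (coprime j n)"
    using n_pos dft_inversion[OF \<open>j < n\<close>, of "\<lambda>j. of_bool (coprime j n)"] by simp
  finally show ?thesis by (simp add: a primitive_power_g_iff)
qed

lemma M_count_eq: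
  "of_nat (M_count u v) = (\<Sum>k<n. \<Sum>l<n. ramanujan_coeff n k * ramanujan_coeff n l * cnj (mixed_sum k l))"
proof -
  have "of_nat (M_count u v) = (\<Sum>a\<in>UNIV. of_bool (primitive_elem a) *
      of_bool (primitive_elem (u * a + v * inverse a)) :: complex)"
    by (simp add: M_count_def sum.If_cases flip: of_bool_conj)
  also have "\<dots> = (\<Sum>a\<in>UNIV. \<Sum>k<n. \<Sum>l<n.
      ramanujan_coeff n k * ramanujan_coeff n l * cnj (chi k a * chi l (u * a + v * inverse a)))"
    unfolding of_bool_primitive_elem sum_product by (simp add: mult_ac)
  also have "\<dots> = (\<Sum>k<n. \<Sum>l<n. \<Sum>a\<in>UNIV.
      ramanujan_coeff n k * ramanujan_coeff n l * cnj (chi k a * chi l (u * a + v * inverse a)))"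
    by (subst sum.swap) (intro sum.cong refl sum.swap)
  finally show ?thesis
    by (simp only: mixed_sum_def cnj_sum sum_distrib_left)
qed

text \<open>The gain over the bound \<open>2\<surd>q\<close> is at least \<open>\<surd>q - 1\<close> for each of \<open>k = l\<close> and \<open>k = -l\<close>. If the
  two coincide, both Jacobi sums have absolute value 1, which suffices unless \<open>q = 3\<close>; in that case
  the sum for \<open>k = 0\<close> vanishes.\<close>

lemma sum_norm_ramanujan_coeff_mixed_sum_le:
  assumes l: "l \<in> {1..<n}"
  defines "s \<equiv> sqrt (real n + 1)"
  shows "(\<Sum>k<n. norm (ramanujan_coeff n k) * norm (mixed_sum k l))
       \<le> 2 * s * (\<Sum>k<n. norm (ramanujan_coeff n k)) - s * norm (ramanujan_coeff n l)"
proof -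
  \<comment> \<open>The weighted deficit against the uniform bound \<open>2 * s\<close>. All
    deficits are non-negative, so it suffices to find a total of
    \<open>s * norm (ramanujan_coeff n l)\<close> in one or two of them.\<close>
  define d where "d k = norm (ramanujan_coeff n k) * (2 * s - norm (mixed_sum k l))" for k
  have d_nonneg: "d k \<ge> 0" for k
    unfolding d_def s_def using norm_mixed_sum_le[OF l, of k] by simp
  have d_le: "sum d A \<le> (\<Sum>k<n. d k)" if "A \<subseteq> {..<n}" for A
    using that d_nonneg by (intro sum_mono2) auto
  \<comment> \<open>This gives \<open>2 * (s - 1) \<ge> s\<close>, so a gain of \<open>s - 1\<close>
    at two places is enough.\<close>
  have s2: "s \<ge> 2" if "n \<ge> 3"
    unfolding s_def using that by (intro real_le_rsqrt) auto
  have "s * norm (ramanujan_coeff n l) \<le> (\<Sum>k<n. d k)"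
  proof (cases "n = 2 * l")
    case False
    then have n3: "n \<ge> 3" using l by auto
    have 1: "norm (ramanujan_coeff n l) * (s - 1) \<le> d l"
      unfolding d_def using norm_mixed_sum_diag_le[OF l] by (intro mult_left_mono) (auto simp: s_def)
    have 2: "norm (ramanujan_coeff n l) * (s - 1) \<le> d (n - l)"
      unfolding d_def using norm_mixed_sum_antidiag_le[OF l] l norm_ramanujan_coeff_minus[of l n]
      by (auto simp: s_def intro!: mult_left_mono)
    have "s * norm (ramanujan_coeff n l) \<le> (2 * (s - 1)) * norm (ramanujan_coeff n l)"
      using s2[OF n3] by (intro mult_right_mono) auto
    also have "\<dots> \<le> sum d {l, n - l}"
      using 1 2 l False by (subst sum.insert) (auto simp: algebra_simps)
    also have "\<dots> \<le> (\<Sum>k<n. d k)" using l by (intro d_le) auto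
    finally show ?thesis .
  next
    case half: True
    show ?thesis
    proof (cases "n \<ge> 3")
      case True
      have "s * norm (ramanujan_coeff n l) \<le> (2 * s - 2) * norm (ramanujan_coeff n l)"
        using s2[OF True] by (intro mult_right_mono) auto
      also have "\<dots> \<le> d l"
        unfolding d_def using norm_mixed_sum_half_le[OF half]
        by (subst mult.commute) (intro mult_left_mono, auto)
      also have "d l \<le> (\<Sum>k<n. d k)" using d_le[of "{l}"] l by simp
      finally show ?thesis .
    next
      case False
      with half l have n2: "n = 2" "l = 1" by auto
      have "norm (ramanujan_coeff n l) \<le> norm (ramanujan_coeff n 0)"
        using norm_ramanujan_coeff_le[OF n_pos, of l] ramanujan_coeff_0[OF n_pos] by simp
      moreover have "s \<ge> 0" by (simp add: s_def)
      ultimately have "s * norm (ramanujan_coeff n l) \<le> (2 * s) * norm (ramanujan_coeff n 0)"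
        by (intro mult_mono) auto
      also have "\<dots> = d 0" using n2 mixed_sum_0_1 by (simp add: d_def)
      also have "\<dots> \<le> (\<Sum>k<n. d k)" using d_le[of "{0}"] n_pos by simp
      finally show ?thesis .
    qed
  qed
  moreover have "(\<Sum>k<n. d k)
      = 2 * s * (\<Sum>k<n. norm (ramanujan_coeff n k)) - (\<Sum>k<n. norm (ramanujan_coeff n k) * norm (mixed_sum k l))"
    by (simp add: d_def algebra_simps sum_subtractf sum_distrib_left)
  ultimately show ?thesis by simp
qed

text \<open>The term \<open>k = l = 0\<close> is the main term, the others with \<open>l = 0\<close>
  give the part with \<open>\<epsilon>\<close>. For \<open>l \<ge> 1\<close> the gains
  \<open>s * c l\<close> are weighted by \<open>c l\<close>, so Parseval sums them to
  \<open>s * (\<theta> - \<theta>\<^sup>2)\<close>, which is the correction with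
  \<open>1/\<theta> - 1\<close>.\<close>

lemma M_count_estimate:
  defines "\<theta> \<equiv> theta n" and "W \<equiv> real (W_fun n)" and "q \<equiv> real n + 1"
    and "\<epsilon> \<equiv> real (card {a. u * a\<^sup>2 + v = 0})"
  shows "\<bar>real (M_count u v) - \<theta>\<^sup>2 * (q - 1 - \<epsilon>)\<bar>
    \<le> \<theta>\<^sup>2 * (2 * sqrt q * (W\<^sup>2 - W - (1/2) * (1/\<theta> - 1)) + \<epsilon> * (W - 1))"
proof -
  define c where "c k = norm (ramanujan_coeff n k)" for k
  define s where "s = sqrt q"
  define A where "A = (\<Sum>k<n. c k)"
  define t where "t k l = ramanujan_coeff n k * ramanujan_coeff n l * cnj (mixed_sum k l)" for k l
  have split0: "{..<n} = insert 0 {1..<n}" using n_pos by auto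
  have \<theta>_pos: "\<theta> > 0" using n_pos by (simp add: \<theta>_def theta_def)
  have c0: "c 0 = \<theta>" using \<theta>_pos by (simp add: c_def ramanujan_coeff_0[OF n_pos] \<theta>_def)
  have A_le: "A \<le> \<theta> * W" unfolding A_def c_def \<theta>_def W_def by (rule sum_norm_ramanujan_coeff_le[OF n_pos])
  have A_split: "A = \<theta> + (\<Sum>k=1..<n. c k)" unfolding A_def split0 by (simp add: c0)
  have A_ge: "\<theta> \<le> A" unfolding A_split by (simp add: sum_nonneg c_def)
  have c_sq: "(\<Sum>k=1..<n. (c k)\<^sup>2) = \<theta> - \<theta>\<^sup>2"
    using sum_norm_ramanujan_coeff_square[OF n_pos] unfolding split0 by (simp add: c_def [symmetric] c0 \<theta>_def [symmetric])
  have s0: "s \<ge> 0" by (simp add: s_def q_def)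
  have "of_nat (M_count u v) = (\<Sum>l<n. \<Sum>k<n. t k l)"
    unfolding M_count_eq t_def by (rule sum.swap)
  also have "\<dots> = t 0 0 + (\<Sum>k=1..<n. t k 0) + (\<Sum>l=1..<n. \<Sum>k<n. t k l)"
    unfolding split0 by simp
  also have "t 0 0 = of_real (\<theta>\<^sup>2 * (q - 1 - \<epsilon>))"
    by (simp add: t_def ramanujan_coeff_0[OF n_pos] mixed_sum_0_0 \<theta>_def q_def \<epsilon>_def power2_eq_square)
  finally have "of_real (real (M_count u v) - \<theta>\<^sup>2 * (q - 1 - \<epsilon>))
      = (\<Sum>k=1..<n. t k 0) + (\<Sum>l=1..<n. \<Sum>k<n. t k l)"
    by simp
  then have "\<bar>real (M_count u v) - \<theta>\<^sup>2 * (q - 1 - \<epsilon>)\<bar>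
      = norm ((\<Sum>k=1..<n. t k 0) + (\<Sum>l=1..<n. \<Sum>k<n. t k l))"
    by (metis norm_of_real)
  also have "\<dots> \<le> (\<Sum>k=1..<n. c k * (\<theta> * \<epsilon>)) + (\<Sum>l=1..<n. c l * (2 * s * A - s * c l))"
  proof (intro order_trans[OF norm_triangle_ineq] add_mono sum_norm_le)
    fix k assume "k \<in> {1..<n}"
    then have "norm (mixed_sum k 0) \<le> \<epsilon>"
      unfolding \<epsilon>_def by (rule norm_mixed_sum_trivial_le)
    then show "norm (t k 0) \<le> c k * (\<theta> * \<epsilon>)"
      using \<theta>_pos c0 by (auto simp: t_def norm_mult c_def mult.assoc intro!: mult_left_mono)
  next
    fix l assume l: "l \<in> {1..<n}"
    have "norm (\<Sum>k<n. t k l) \<le> (\<Sum>k<n. norm (t k l))" by (rule norm_sum)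
    also have "\<dots> = c l * (\<Sum>k<n. c k * norm (mixed_sum k l))"
      by (simp add: t_def norm_mult c_def sum_distrib_left mult_ac)
    also have "\<dots> \<le> c l * (2 * s * A - s * c l)"
      unfolding c_def A_def s_def q_def
      by (intro mult_left_mono sum_norm_ramanujan_coeff_mixed_sum_le[OF l]) simp
    finally show "norm (\<Sum>k<n. t k l) \<le> c l * (2 * s * A - s * c l)" .
  qed
  also have "(\<Sum>k=1..<n. c k * (\<theta> * \<epsilon>)) = (A - \<theta>) * (\<theta> * \<epsilon>)"
    by (simp add: A_split sum_distrib_right)
  also have "(\<Sum>l=1..<n. c l * (2 * s * A - s * c l)) = 2 * s * (A * (A - \<theta>)) - s * (\<theta> - \<theta>\<^sup>2)"
  proof -
    have "(\<Sum>l=1..<n. c l * (2 * s * A - s * c l)) = 2 * s * A * (\<Sum>l=1..<n. c l) - s * (\<Sum>l=1..<n. (c l)\<^sup>2)"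
      by (simp add: algebra_simps sum_subtractf sum_distrib_left power2_eq_square)
    then show ?thesis using A_split c_sq by simp
  qed
  \<comment> \<open>Only now is \<open>A\<close> replaced by its bound \<open>\<theta> * W\<close>;
    the product \<open>A * (A - \<theta>)\<close> is monotone because
    \<open>A \<ge> \<theta>\<close>.\<close>
  also have "(A - \<theta>) * (\<theta> * \<epsilon>) + (2 * s * (A * (A - \<theta>)) - s * (\<theta> - \<theta>\<^sup>2))
    \<le> (\<theta> * W - \<theta>) * (\<theta> * \<epsilon>) + (2 * s * (\<theta> * W * (\<theta> * W - \<theta>)) - s * (\<theta> - \<theta>\<^sup>2))"
    using A_le A_ge \<theta>_pos s0
    by (intro add_mono diff_mono mult_right_mono mult_left_mono mult_mono order_refl)
       (auto simp: \<epsilon>_def)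
  also have "\<dots> = \<theta>\<^sup>2 * (2 * s * (W\<^sup>2 - W - (1/2) * (1/\<theta> - 1)) + \<epsilon> * (W - 1))"
    using \<theta>_pos by (simp add: field_simps power2_eq_square)
  finally show ?thesis by (simp only: s_def)
qed

end

theorem theorem6p1:
  fixes u v :: "'a::{field,finite}"
  assumes "u \<noteq> 0" and "v \<noteq> 0"
  defines "q \<equiv> card (UNIV::'a set)"
  defines "\<theta> \<equiv> theta (q - 1)"
  defines "W \<equiv> real (W_fun (q - 1))"
  defines "\<epsilon> \<equiv> real (card {x::'a. u * x ^ 2 + v = 0})"
  shows "\<bar>real (M_count u v) - \<theta>^2 * (real q - 1 - \<epsilon>)\<bar>
           \<le> \<theta>^2 * (2 * sqrt (real q) * (W^2 - W - (1/2) * (1/\<theta> - 1)) + \<epsilon> * (W - 1))"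
proof -
  obtain g :: 'a where "primitive_elem g"
    using ex_primitive_elem by blast
  then interpret field_generator_uv g "card (UNIV - {0 :: 'a})" u v
    using assms by unfold_locales auto
  have "card (UNIV - {0 :: 'a}) = q - 1" "real (q - 1) + 1 = real q"
    using card_field by (simp_all add: q_def)
  then show ?thesis
    using M_count_estimate unfolding \<theta>_def W_def \<epsilon>_def by simp
qed

end
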